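(* Let $X$ be a real Banach space with a normalized unconditional basis $(\varphi_i)_{i\ge1}$ whose unconditional constant is $1$. Then for every $n\in\mathbb{N}_{\mathcal H}$ $$\varrho_n\ge\max\left\{\frac{1}{\sqrt2}\,\lambda(n)\,\sqrt n,\ n\right\}.$$
   Context: A (Schauder) basis $(\varphi_i)$ of a Banach space $X$ is normalized if $\|\varphi_i\|=1$ for all $i$. It is unconditional if $(\varphi_{\pi(i)})$ is a basis of $X$ for every permutation $\pi$ of $\mathbb{N}$. Its unconditional constant is the smallest $K$ such that $\|\sum_i\lambda_i\alpha_i\varphi_i\|\le K\sup_i|\lambda_i|\,\|\sum_i\alpha_i\varphi_i\|$ for all scalars $(\alpha_i)$ for which $\sum_i\alpha_i\varphi_i$ converges and all bounded scalar sequences $(\lambda_i)$. $\lambda(n)=\left\|\sum_{i=1}^n\varphi_i\right\|$. A Hadamard matrix of order $n$ is an $n\times n$ matrix with entries $\pm1$ whose columns (equivalently, rows) are pairwise orthogonal. $\mathbb{N}_{\mathcal H}$ is the set of positive integers $n$ for which a Hadamard matrix of order $n$ exists, and $\mathcal H_n^{all}$ is the set of all Hadamard matrices of order $n$. For $\mathcal H_n=[h^n_{ki}]\in\mathcal H_n^{all}$ ($k$ the row index, $i$ the column index) put $$\varrho_{\mathcal H_n}=\max_{1\le m\le n}\left\|\sum_{i=1}^n\left(\sum_{k=1}^m h^n_{ki}\right)\varphi_i\right\|,\qquad \varrho_n=\max_{\mathcal H_n\in\mathcal H_n^{all}}\varrho_{\mathcal H_n}.$$ *)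

theory Defs
  imports Complex_Main "Jordan_Normal_Form.Matrix"
begin

text \<open>
  Sequences and matrices are indexed from 0, so \<open>\<phi> i\<close> is the basis vector
  \<open>\<phi>\<^sub>i\<^sub>+\<^sub>1\<close> of the usual numbering from 1.
\<close>

definition schauder_basis :: "(nat \<Rightarrow> 'a::banach) \<Rightarrow> bool" where
  "schauder_basis \<phi> \<longleftrightarrow> (\<forall>x. \<exists>!a. (\<lambda>i. a i *\<^sub>R \<phi> i) sums x)"

definition normalized :: "(nat \<Rightarrow> 'a::banach) \<Rightarrow> bool" where
  "normalized \<phi> \<longleftrightarrow> (\<forall>i. norm (\<phi> i) = 1)"

definition unconditional_basis :: "(nat \<Rightarrow> 'a::banach) \<Rightarrow> bool" where
  "unconditional_basis \<phi> \<longleftrightarrow> (\<forall>\<pi>. bij \<pi> \<longrightarrow> schauder_basis (\<lambda>i. \<phi> (\<pi> i)))"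

text \<open>
  Convergence of the multiplied series is implicit in the usual way of writing the inequality;
  it is automatic for an unconditional basis, but has to be spelled out here because
  \<^const>\<open>suminf\<close> is unspecified on divergent series.
\<close>

definition unconditional_bound :: "(nat \<Rightarrow> 'a::banach) \<Rightarrow> real \<Rightarrow> bool" where
  "unconditional_bound \<phi> K \<longleftrightarrow>
    (\<forall>\<alpha> l. summable (\<lambda>i. \<alpha> i *\<^sub>R \<phi> i) \<longrightarrow> Bseq l \<longrightarrow>
       summable (\<lambda>i. (l i * \<alpha> i) *\<^sub>R \<phi> i) \<and>
       norm (\<Sum>i. (l i * \<alpha> i) *\<^sub>R \<phi> i) \<le> K * (SUP i. \<bar>l i\<bar>) * norm (\<Sum>i. \<alpha> i *\<^sub>R \<phi> i))"

text \<open>A relation rather than a function, so that no junk value arises when there is no bound.\<close>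

definition is_unconditional_constant :: "(nat \<Rightarrow> 'a::banach) \<Rightarrow> real \<Rightarrow> bool" where
  "is_unconditional_constant \<phi> K \<longleftrightarrow>
    unconditional_bound \<phi> K \<and> (\<forall>K'. unconditional_bound \<phi> K' \<longrightarrow> K \<le> K')"

definition lam :: "(nat \<Rightarrow> 'a::banach) \<Rightarrow> nat \<Rightarrow> real" where
  "lam \<phi> n = norm (\<Sum>i<n. \<phi> i)"

definition hadamard_matrices :: "nat \<Rightarrow> real mat set" where
  "hadamard_matrices n =
    {H \<in> carrier_mat n n.
       (\<forall>k<n. \<forall>i<n. H $$ (k, i) \<in> {1, -1}) \<and>
       (\<forall>i<n. \<forall>j<n. i \<noteq> j \<longrightarrow> scalar_prod (col H i) (col H j) = 0)}"

definition hadamard_orders :: "nat set" where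
  "hadamard_orders = {n. 0 < n \<and> hadamard_matrices n \<noteq> {}}"

definition rho_mat :: "(nat \<Rightarrow> 'a::banach) \<Rightarrow> nat \<Rightarrow> real mat \<Rightarrow> real" where
  "rho_mat \<phi> n H = (MAX m\<in>{1..n}. norm (\<Sum>i<n. (\<Sum>k<m. H $$ (k, i)) *\<^sub>R \<phi> i))"

text \<open>The maximum is over a finite set, and a nonempty one if \<open>n \<in> hadamard_orders\<close>.\<close>

definition rho :: "(nat \<Rightarrow> 'a::banach) \<Rightarrow> nat \<Rightarrow> real" where
  "rho \<phi> n = (MAX H\<in>hadamard_matrices n. rho_mat \<phi> n H)"

end

theory Submission
  imports Defs
begin

text \<open>
  Only the full row sum is needed: for \<open>H\<close> Hadamard of order \<open>n\<close> the norm occurring for \<open>m = n\<close> is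
  that of \<open>\<Sum>\<^sub>i s\<^sub>i \<phi>\<^sub>i\<close>, where \<open>s\<^sub>i\<close> is the sum of column \<open>i\<close>. Negating rows preserves the Hadamard
  property, so \<open>rho\<close> dominates this norm for every choice of row signs applied to one fixed
  Hadamard matrix \<open>H\<close> (lemma \<open>rho_ge_flipped\<close>). Both bounds come from good choices of signs.

  For the bound \<open>n\<close>, let the signs be the first column of \<open>H\<close>. The column sums become the
  inner products of the first column with all columns, that is \<open>n, 0, \<dots>, 0\<close>, and the norm is \<open>n\<close>.

  For the other bound, choose the signs at random. Unconditional constant \<open>1\<close> permits replacing
  every \<open>s\<^sub>i\<close> by \<open>\<bar>s\<^sub>i\<bar>\<close>. The entries of a column are \<open>\<plusminus>1\<close>, so each \<open>s\<^sub>i\<close> is distributed as a sum of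
  \<open>n\<close> independent random signs, whatever \<open>i\<close> is (lemma \<open>sum_flips_invariant\<close>). By convexity of the
  norm, the mean norm is at least the norm of the mean, which is \<open>c\<^sub>n \<Sum>\<^sub>i \<phi>\<^sub>i\<close> with \<open>c\<^sub>n\<close> the mean absolute
  value of such a sum. The constant \<open>1 / \<surd>2\<close> is that of the sharp Khintchine inequality
  \<open>c\<^sub>n \<ge> \<surd>(n / 2)\<close> for equal coefficients (lemma \<open>sum_abs_signs_ge\<close>). Here \<open>c\<^sub>n\<close> is bounded below by a
  middle binomial coefficient through a telescoping sum, and that coefficient by
  \<open>4\<^sup>m / (2 \<surd>m)\<close> through induction.
\<close>

section \<open>The mean absolute value of a sum of random signs\<close>

text \<open>
  A choice of \<open>n\<close> signs is encoded by the set \<open>T\<close> of positions that carry \<open>-1\<close>. Means over random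
  signs thus become sums over \<open>Pow {..<n}\<close>, scaled by \<open>2 ^ n\<close>.
\<close>

definition flip_sign :: "nat set \<Rightarrow> nat \<Rightarrow> real" where
  "flip_sign T k = (if k \<in> T then -1 else 1)"

lemma sum_flip_sign:
  assumes "T \<subseteq> {..<n}"
  shows "(\<Sum>k<n. flip_sign T k) = real n - 2 * real (card T)"
proof -
  have "(\<Sum>k<n. flip_sign T k) = (\<Sum>k<n. 1 - 2 * (if k \<in> T then 1 else 0))"
    by (rule sum.cong) (auto simp: flip_sign_def)
  also have "\<dots> = real n - 2 * real (card T)"
    using assms by (simp add: sum_subtractf sum_distrib_left [symmetric] sum.If_cases Int_absorb1)
  finally show ?thesis .
qed

lemma sum_Pow_card:
  fixes f :: "nat \<Rightarrow> real"
  shows "(\<Sum>T\<in>Pow {..<n}. f (card T)) = (\<Sum>j\<le>n. real (n choose j) * f j)"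
proof -
  have fib: "{T \<in> Pow {..<n}. card T = j} = {T. T \<subseteq> {..<n} \<and> card T = j}" for j
    by auto
  have "(\<Sum>T\<in>Pow {..<n}. f (card T)) = (\<Sum>j\<le>n. \<Sum>T | T \<in> Pow {..<n} \<and> card T = j. f (card T))"
    by (rule sum.group [symmetric]) (use card_mono [of "{..<n}"] in auto)
  also have "\<dots> = (\<Sum>j\<le>n. real (n choose j) * f j)"
    by (rule sum.cong) (simp_all add: fib n_subsets)
  finally show ?thesis .
qed

text \<open>
  The sum telescopes since \<open>(p + 1) (n choose (p + 1)) = (n - p) (n choose p)\<close>. It lacks absolute
  values, but the terms change sign only once, at the middle.
\<close>

lemma sum_binomial_lower_tail:
  "(\<Sum>j<p. real (n choose j) * (real n - 2 * real j)) = real p * real (n choose p)"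
proof (induction p)
  case 0
  then show ?case by simp
next
  case (Suc p)
  have step: "real (Suc p) * real (n choose Suc p) = (real n - real p) * real (n choose p)"
  proof (cases "p \<le> n")
    case True
    have "Suc p * (n choose Suc p) = (n - p) * (n choose p)"
      by (simp only: binomial_absorption binomial_absorb_comp)
    then have "real (Suc p) * real (n choose Suc p) = real (n - p) * real (n choose p)"
      by (metis of_nat_mult)
    then show ?thesis using True by (simp add: of_nat_diff)
  qed (simp add: binomial_eq_0)
  show ?case unfolding step using Suc by (simp add: algebra_simps)
qed

text \<open>
  The signed terms add up to zero over the whole range, so the sum of the absolute values is at
  least the part below \<open>p\<close> minus the part from \<open>p\<close> on, which is twice the lower tail. Equality
  holds if \<open>p\<close> is the middle.
\<close>

lemma sum_abs_signs_ge_binomial: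
  assumes "p \<le> Suc n"
  shows "2 * real p * real (n choose p) \<le> (\<Sum>T\<in>Pow {..<n}. \<bar>\<Sum>k<n. flip_sign T k\<bar>)"
proof -
  define g where "g j = real (n choose j) * (real n - 2 * real j)" for j
  have split: "sum h {..n} = sum h {..<p} + sum h {p..n}" for h :: "nat \<Rightarrow> real"
  proof -
    have "{..n} = {..<p} \<union> {p..n}" using assms by auto
    then show ?thesis by (simp add: sum.union_disjoint ivl_disj_int)
  qed
  \<comment> \<open>the tail formula at \<open>p = n + 1\<close>, where the binomial coefficient vanishes\<close>
  have total: "sum g {..n} = 0"
    using sum_binomial_lower_tail [of n "Suc n"] by (simp add: g_def lessThan_Suc_atMost)
  have low: "sum g {..<p} = real p * real (n choose p)"
    using sum_binomial_lower_tail [of n p] by (simp add: g_def)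
  have "2 * real p * real (n choose p) = sum g {..<p} - sum g {p..n}"
    using total low split [of g] by simp
  also have "\<dots> \<le> (\<Sum>j<p. \<bar>g j\<bar>) + (\<Sum>j=p..n. \<bar>g j\<bar>)"
    using sum_abs [of g "{..<p}"] sum_abs [of g "{p..n}"] by linarith
  also have "\<dots> = (\<Sum>j\<le>n. \<bar>g j\<bar>)"
    by (rule split [symmetric])
  also have "\<dots> = (\<Sum>j\<le>n. real (n choose j) * \<bar>real n - 2 * real j\<bar>)"
    by (simp add: g_def abs_mult)
  also have "\<dots> = (\<Sum>T\<in>Pow {..<n}. \<bar>real n - 2 * real (card T)\<bar>)"
    by (rule sum_Pow_card [symmetric])
  also have "\<dots> = (\<Sum>T\<in>Pow {..<n}. \<bar>\<Sum>k<n. flip_sign T k\<bar>)"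
    by (rule sum.cong) (simp_all add: sum_flip_sign)
  finally show ?thesis .
qed

lemma central_binomial_Suc:
  "Suc m * (2 * Suc m choose Suc m) = 2 * (2 * m + 1) * (2 * m choose m)"
proof -
  have 1: "Suc m * (2 * Suc m choose Suc m) = 2 * Suc m * (Suc (2 * m) choose m)"
    using Suc_times_binomial [of m "Suc (2 * m)"] by simp
  have 2: "Suc m * (Suc (2 * m) choose m) = Suc (2 * m) * (2 * m choose m)"
    using binomial_absorb_comp [of "Suc (2 * m)" m] by simp
  have "2 * Suc m * (Suc (2 * m) choose m) = 2 * (Suc m * (Suc (2 * m) choose m))"
    by (simp only: mult.assoc)
  with 1 2 show ?thesis by simp
qed

text \<open>
  By the recurrence above, the induction step for the squared inequality reduces to
  \<open>4 m (m + 1) \<le> (2 m + 1)\<^sup>2\<close>. This has the order \<open>1 / \<surd>m\<close> of the true size, which the simpler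
  bound \<open>4 ^ m / (2 m)\<close> misses.
\<close>

lemma central_binomial_ge:
  "0 < m \<Longrightarrow> 4 ^ m \<le> 2 * sqrt (real m) * real (2 * m choose m)"
proof -
  have sq: "16 ^ m \<le> 4 * real m * (real (2 * m choose m))\<^sup>2" if "0 < m" for m
    using that
  proof (induction m rule: nat_induct_non_zero)
    case 1
    then show ?case by (simp add: numeral_2_eq_2)
  next
    case (Suc m)
    define b where "b = real (2 * m choose m)"
    define c where "c = real (2 * Suc m choose Suc m)"
    have rec: "(real m + 1) * c = 2 * (2 * real m + 1) * b"
      using arg_cong [OF central_binomial_Suc [of m], of real] unfolding b_def c_def
      by (simp only: of_nat_mult of_nat_Suc of_nat_add of_nat_numeral of_nat_1) (simp add: algebra_simps)
    have "(real m + 1) * 16 ^ Suc m = 16 * (real m + 1) * 16 ^ m"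
      by simp
    also have "\<dots> \<le> 16 * (real m + 1) * (4 * real m * b\<^sup>2)"
      unfolding b_def by (rule mult_left_mono [OF Suc.IH]) simp
    also have "\<dots> = 16 * (4 * real m * (real m + 1)) * b\<^sup>2" by simp
    also have "\<dots> \<le> 16 * (2 * real m + 1)\<^sup>2 * b\<^sup>2"
      by (intro mult_right_mono mult_left_mono) (simp_all add: power2_eq_square algebra_simps)
    also have "\<dots> = 4 * (2 * (2 * real m + 1) * b)\<^sup>2"
      by (simp add: power2_eq_square algebra_simps)
    also have "\<dots> = (real m + 1) * (4 * real (Suc m) * c\<^sup>2)"
      unfolding rec [symmetric] by (simp add: power2_eq_square algebra_simps)
    finally show ?case unfolding c_def by simp
  qed
  assume "0 < m"
  have "(4 ^ m)\<^sup>2 \<le> (2 * sqrt (real m) * real (2 * m choose m))\<^sup>2"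
  proof -
    have "(4 ^ m)\<^sup>2 = (16 ^ m :: real)"
      by (simp add: power2_eq_square flip: power_mult_distrib)
    moreover have "(2 * sqrt (real m) * real (2 * m choose m))\<^sup>2 = 4 * real m * (real (2 * m choose m))\<^sup>2"
      by (simp add: power_mult_distrib)
    ultimately show ?thesis
      using sq [OF \<open>0 < m\<close>] by simp
  qed
  then show ?thesis
    by (rule power2_le_imp_le) simp
qed

text \<open>
  Khintchine's inequality between the first and the second moment of a sum of \<open>n\<close> random signs,
  with its best constant: equality holds for \<open>n = 2\<close>. For odd \<open>n = 2 m + 1\<close> the middle coefficient is
  half a central one, which even gives the bound \<open>\<surd>(m + 1)\<close> of the next even number.
\<close>

lemma sum_abs_signs_ge:
  "2 ^ n * sqrt (real n / 2) \<le> (\<Sum>T\<in>Pow {..<n}. \<bar>\<Sum>k<n. flip_sign T k\<bar>)"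
proof (cases "even n")
  case True
  then obtain m where n: "n = 2 * m" by (elim evenE)
  show ?thesis
  proof (cases "m = 0")
    case False
    then have "0 < m" by simp
    have "2 ^ n * sqrt (real n / 2) = 4 ^ m * sqrt (real m)"
      by (simp add: n power_mult)
    also have "\<dots> \<le> 2 * sqrt (real m) * real (n choose m) * sqrt (real m)"
      using central_binomial_ge [OF \<open>0 < m\<close>] by (intro mult_right_mono) (simp_all add: n)
    also have "\<dots> = 2 * real m * real (n choose m)"
      by simp
    also have "\<dots> \<le> (\<Sum>T\<in>Pow {..<n}. \<bar>\<Sum>k<n. flip_sign T k\<bar>)"
      by (rule sum_abs_signs_ge_binomial) (simp add: n)
    finally show ?thesis .
  qed (simp add: n)
next
  case False
  then obtain m where n: "n = 2 * m + 1" by (elim oddE)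
  have half: "2 * (n choose Suc m) = (2 * Suc m choose Suc m)"
    using Suc_times_binomial [of m n] binomial_symmetric [of m n] n
    by (simp add: algebra_simps)
  have "2 ^ n * sqrt (real n / 2) \<le> 2 ^ n * sqrt (real (Suc m))"
    by (simp add: n)
  also have "\<dots> = 4 ^ Suc m / 2 * sqrt (real (Suc m))"
    by (simp add: n power_mult)
  also have "\<dots> \<le> 2 * sqrt (real (Suc m)) * real (2 * Suc m choose Suc m) / 2 * sqrt (real (Suc m))"
    by (intro mult_right_mono divide_right_mono central_binomial_ge) simp_all
  also have "\<dots> = real (Suc m) * real (2 * Suc m choose Suc m)"
    using real_sqrt_mult_self [of "real (Suc m)"] by (simp add: mult.assoc mult.left_commute)
  also have "\<dots> = 2 * real (Suc m) * real (n choose Suc m)"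
    unfolding half [symmetric] by simp
  also have "\<dots> \<le> (\<Sum>T\<in>Pow {..<n}. \<bar>\<Sum>k<n. flip_sign T k\<bar>)"
    by (rule sum_abs_signs_ge_binomial) (simp add: n)
  finally show ?thesis .
qed

text \<open>
  Multiplying uniformly random signs by fixed signs does not change their joint distribution: on
  the sets \<open>T\<close> this is the bijection that takes the symmetric difference with \<open>{k. h k = -1}\<close>.
\<close>

lemma sum_flips_invariant:
  fixes f :: "real \<Rightarrow> real"
  assumes "\<And>k. k < n \<Longrightarrow> h k \<in> {1, -1}"
  shows "(\<Sum>T\<in>Pow {..<n}. f (\<Sum>k<n. flip_sign T k * h k))
       = (\<Sum>T\<in>Pow {..<n}. f (\<Sum>k<n. flip_sign T k))"
proof -
  define N where "N = {k. k < n \<and> h k = -1}"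
  define tog where "tog T = (T - N) \<union> (N - T)" for T
  show ?thesis
  proof (rule sum.reindex_bij_witness [where i = tog and j = tog])
    fix T assume "T \<in> Pow {..<n}"
    have "flip_sign (tog T) k = flip_sign T k * h k" if "k < n" for k
      using assms [OF that] that by (auto simp: flip_sign_def tog_def N_def)
    then show "f (\<Sum>k<n. flip_sign (tog T) k) = f (\<Sum>k<n. flip_sign T k * h k)"
      by simp
  qed (auto simp: tog_def N_def)
qed

section \<open>Hadamard matrices with flipped rows\<close>

definition flip_rows :: "nat set \<Rightarrow> real mat \<Rightarrow> real mat" where
  "flip_rows T H = mat (dim_row H) (dim_col H) (\<lambda>(k, i). flip_sign T k * H $$ (k, i))"

lemma scalar_prod_cols:
  assumes "H \<in> carrier_mat n n" "i < n" "j < n"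
  shows "scalar_prod (col H i) (col H j) = (\<Sum>k<n. H $$ (k, i) * H $$ (k, j))"
  using assms by (simp add: scalar_prod_def lessThan_atLeast0)

lemma flip_rows_hadamard:
  assumes "H \<in> hadamard_matrices n"
  shows "flip_rows T H \<in> hadamard_matrices n"
proof -
  have H: "H \<in> carrier_mat n n" 
    using assms by (simp add: hadamard_matrices_def)
  have F: "flip_rows T H \<in> carrier_mat n n" 
    using H by (simp add: flip_rows_def)
  have e: "flip_rows T H $$ (k, i) = flip_sign T k * H $$ (k, i)" if "k < n" "i < n" for k i
    using H that by (simp add: flip_rows_def)
  have "scalar_prod (col (flip_rows T H) i) (col (flip_rows T H) j) = scalar_prod (col H i) (col H j)"
    if "i < n" "j < n" for i j
    unfolding scalar_prod_cols [OF F that] scalar_prod_cols [OF H that]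
    by (rule sum.cong) (use that in \<open>auto simp: e flip_sign_def\<close>)
  with assms F show ?thesis
    by (auto simp: hadamard_matrices_def e flip_sign_def)
qed

text \<open>
  A matrix with entries \<open>\<plusminus>1\<close> is determined by the positions of its entries \<open>1\<close>. Finiteness makes
  the maximum in \<open>rho\<close> an upper bound of its members.
\<close>

lemma finite_hadamard_matrices: "finite (hadamard_matrices n)"
proof -
  define ones where "ones H = {(k, i). k < n \<and> i < n \<and> H $$ (k, i) = 1}" for H :: "real mat"
  have "inj_on ones (hadamard_matrices n)"
  proof (rule inj_onI)
    fix H H' assume HH: "H \<in> hadamard_matrices n" "H' \<in> hadamard_matrices n" "ones H = ones H'"
    show "H = H'"
    proof (rule eq_matI)
      fix k i assume "k < dim_row H'" "i < dim_col H'"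
      then have ki: "k < n" "i < n" using HH by (auto simp: hadamard_matrices_def)
      have "H $$ (k, i) = 1 \<longleftrightarrow> H' $$ (k, i) = 1"
        using HH(3) ki by (auto simp: ones_def)
      moreover have "H $$ (k, i) \<in> {1, -1}" "H' $$ (k, i) \<in> {1, -1}"
        using HH(1,2) ki by (auto simp: hadamard_matrices_def)
      ultimately show "H $$ (k, i) = H' $$ (k, i)" by auto
    qed (use HH in \<open>auto simp: hadamard_matrices_def\<close>)
  qed
  moreover have "ones ` hadamard_matrices n \<subseteq> Pow ({..<n} \<times> {..<n})"
    by (auto simp: ones_def)
  ultimately show ?thesis
    by (meson finite_Pow_iff finite_SigmaI finite_imageD finite_lessThan finite_subset)
qed

text \<open>
  The case \<open>m = n\<close> of the definition of \<open>rho_mat\<close>, for the matrix with flipped rows. This leaves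
  the signs as the only choice to be made.
\<close>

lemma rho_ge_flipped:
  fixes \<phi> :: "nat \<Rightarrow> 'a::banach"
  assumes "H \<in> hadamard_matrices n" "0 < n"
  shows "norm (\<Sum>i<n. (\<Sum>k<n. flip_sign T k * H $$ (k, i)) *\<^sub>R \<phi> i) \<le> rho \<phi> n"
proof -
  have H: "H \<in> carrier_mat n n" 
    using assms by (simp add: hadamard_matrices_def)
  have "(\<Sum>i<n. (\<Sum>k<n. flip_sign T k * H $$ (k, i)) *\<^sub>R \<phi> i)
      = (\<Sum>i<n. (\<Sum>k<n. flip_rows T H $$ (k, i)) *\<^sub>R \<phi> i)"
    using H by (intro sum.cong refl arg_cong2 [where f = scaleR]) (auto simp: flip_rows_def)
  also have "norm \<dots> \<le> rho_mat \<phi> n (flip_rows T H)"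
    unfolding rho_mat_def using assms(2) by (intro Max_ge) auto
  also have "\<dots> \<le> rho \<phi> n"
    unfolding rho_def using assms(1) by (intro Max_ge) (auto simp: finite_hadamard_matrices flip_rows_hadamard)
  finally show ?thesis .
qed

section \<open>The two lower bounds\<close>

text \<open>
  The multipliers are the signs of the coefficients, so their supremum is \<open>1\<close>. Finite sums are
  treated as series by extending the coefficients with zeros.
\<close>

lemma norm_sum_abs_le:
  fixes \<phi> :: "nat \<Rightarrow> 'a::banach"
  assumes "unconditional_bound \<phi> 1"
  shows "norm (\<Sum>i<n. \<bar>a i\<bar> *\<^sub>R \<phi> i) \<le> norm (\<Sum>i<n. a i *\<^sub>R \<phi> i)"
proof -
  define b where "b i = (if i < n then a i else 0)" for i
  define l where "l i = (if a i < 0 then -1 else 1 :: real)" for i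
  have abs_l: "\<bar>l i\<bar> = 1" for i by (simp add: l_def)
  have fin: "(\<Sum>i. (c i * b i) *\<^sub>R \<phi> i) = (\<Sum>i<n. (c i * a i) *\<^sub>R \<phi> i)" for c
    by (subst suminf_finite [of "{..<n}"]) (auto simp: b_def)
  have "summable (\<lambda>i. b i *\<^sub>R \<phi> i)"
    by (rule summable_finite [of "{..<n}"]) (auto simp: b_def)
  moreover have "Bseq l"
    by (rule BseqI' [of _ 1]) (simp add: abs_l)
  ultimately have "norm (\<Sum>i. (l i * b i) *\<^sub>R \<phi> i) \<le> 1 * (SUP i. \<bar>l i\<bar>) * norm (\<Sum>i. b i *\<^sub>R \<phi> i)"
    using assms unfolding unconditional_bound_def by blast
  then have "norm (\<Sum>i<n. (l i * a i) *\<^sub>R \<phi> i) \<le> norm (\<Sum>i<n. a i *\<^sub>R \<phi> i)"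
    using fin [of l] fin [of "\<lambda>_. 1"] by (simp add: abs_l)
  moreover have "l i * a i = \<bar>a i\<bar>" for i by (simp add: l_def)
  ultimately show ?thesis by simp
qed

text \<open>
  Flipping rows so that the first column becomes constant \<open>1\<close> turns orthogonality to that column
  into vanishing column sums, and only \<open>n \<phi>\<^sub>0\<close> remains.
\<close>

lemma rho_ge_order:
  fixes \<phi> :: "nat \<Rightarrow> 'a::banach"
  assumes "normalized \<phi>" "H \<in> hadamard_matrices n" "0 < n"
  shows "real n \<le> rho \<phi> n"
proof -
  have H: "H \<in> carrier_mat n n" "\<And>k i. k < n \<Longrightarrow> i < n \<Longrightarrow> H $$ (k, i) \<in> {1, -1}"
    "\<And>i j. i < n \<Longrightarrow> j < n \<Longrightarrow> i \<noteq> j \<Longrightarrow> scalar_prod (col H i) (col H j) = 0"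
    using assms(2) by (auto simp: hadamard_matrices_def)
  define T where "T = {k. H $$ (k, 0) = -1}"
  have flip: "flip_sign T k = H $$ (k, 0)" if "k < n" for k
    using H(2) [OF that assms(3)] by (auto simp: flip_sign_def T_def)
  have col_sum: "(\<Sum>k<n. flip_sign T k * H $$ (k, i)) = (if i = 0 then real n else 0)"
    if "i < n" for i
  proof -
    have "(\<Sum>k<n. flip_sign T k * H $$ (k, i)) = (\<Sum>k<n. H $$ (k, 0) * H $$ (k, i))"
      by (simp add: flip)
    also have "\<dots> = (if i = 0 then real n else 0)"
    proof (cases "i = 0")
      case True
      have "(\<Sum>k<n. H $$ (k, 0) * H $$ (k, 0)) = (\<Sum>k<n. 1)"
        using H(2) assms(3) by (intro sum.cong) fastforce+
      with True show ?thesis by simp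
    next
      case False
      then show ?thesis
        using H(3) [of 0 i] scalar_prod_cols [OF H(1), of 0 i] that assms(3) by simp
    qed
    finally show ?thesis .
  qed
  have "(\<Sum>i<n. (\<Sum>k<n. flip_sign T k * H $$ (k, i)) *\<^sub>R \<phi> i)
      = (\<Sum>i<n. if i = 0 then real n *\<^sub>R \<phi> i else 0)"
    by (rule sum.cong) (auto simp: col_sum)
  also have "\<dots> = real n *\<^sub>R \<phi> 0"
    using assms(3) by simp
  finally have "norm (\<Sum>i<n. (\<Sum>k<n. flip_sign T k * H $$ (k, i)) *\<^sub>R \<phi> i) = real n"
    using assms(1) by (simp add: normalized_def)
  then show ?thesis
    using rho_ge_flipped [OF assms(2,3), of T \<phi>] by simp
qed

text \<open>
  Some choice of row signs is at least as good as the mean. Absolute values must be taken before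
  averaging, because the signed column sums average to zero. Afterwards all coefficients have the
  same mean, and the averaged vector is a multiple of \<open>\<Sum>i<n. \<phi> i\<close>.
\<close>

lemma rho_ge_lam_sqrt:
  fixes \<phi> :: "nat \<Rightarrow> 'a::banach"
  assumes "unconditional_bound \<phi> 1" "H \<in> hadamard_matrices n" "0 < n"
  shows "sqrt (real n / 2) * lam \<phi> n \<le> rho \<phi> n"
proof -
  define s where "s T i = (\<Sum>k<n. flip_sign T k * H $$ (k, i))" for T i
  define A where "A = (\<Sum>T\<in>Pow {..<n}. \<bar>\<Sum>k<n. flip_sign T k\<bar>)"
  have col_mean: "(\<Sum>T\<in>Pow {..<n}. \<bar>s T i\<bar>) = A" if "i < n" for i
    unfolding s_def A_def
    by (rule sum_flips_invariant [where f = abs]) (use assms(2) that in \<open>auto simp: hadamard_matrices_def\<close>)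
  have "2 ^ n * (sqrt (real n / 2) * lam \<phi> n) \<le> A * lam \<phi> n"
    using sum_abs_signs_ge [of n] unfolding A_def mult.assoc [symmetric]
    by (intro mult_right_mono) (simp_all add: lam_def)
  also have "\<dots> = norm (\<Sum>i<n. A *\<^sub>R \<phi> i)"
    by (simp add: lam_def A_def sum_nonneg flip: scaleR_sum_right)
  also have "(\<Sum>i<n. A *\<^sub>R \<phi> i) = (\<Sum>i<n. \<Sum>T\<in>Pow {..<n}. \<bar>s T i\<bar> *\<^sub>R \<phi> i)"
    by (intro sum.cong refl) (simp add: col_mean flip: scaleR_sum_left)
  also have "\<dots> = (\<Sum>T\<in>Pow {..<n}. \<Sum>i<n. \<bar>s T i\<bar> *\<^sub>R \<phi> i)"
    by (rule sum.swap)
  also have "norm \<dots> \<le> (\<Sum>T\<in>Pow {..<n}. norm (\<Sum>i<n. \<bar>s T i\<bar> *\<^sub>R \<phi> i))"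
    by (rule norm_sum)
  also have "\<dots> \<le> (\<Sum>T\<in>Pow {..<n}. rho \<phi> n)"
  proof (rule sum_mono)
    fix T
    have "norm (\<Sum>i<n. \<bar>s T i\<bar> *\<^sub>R \<phi> i) \<le> norm (\<Sum>i<n. s T i *\<^sub>R \<phi> i)"
      by (rule norm_sum_abs_le [OF assms(1)])
    also have "\<dots> \<le> rho \<phi> n"
      unfolding s_def by (rule rho_ge_flipped [OF assms(2,3)])
    finally show "norm (\<Sum>i<n. \<bar>s T i\<bar> *\<^sub>R \<phi> i) \<le> rho \<phi> n" .
  qed
  also have "\<dots> = 2 ^ n * rho \<phi> n"
    by (simp add: card_Pow)
  finally show ?thesis by simp
qed

theorem theorem4p2:
  fixes \<phi> :: "nat \<Rightarrow> 'a::banach" and n :: nat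
  assumes "unconditional_basis \<phi>"
    and "normalized \<phi>"
    and "is_unconditional_constant \<phi> 1"
    and "n \<in> hadamard_orders"
  shows "rho \<phi> n \<ge> max (1 / sqrt 2 * lam \<phi> n * sqrt (real n)) (real n)"
proof -
  obtain H where H: "H \<in> hadamard_matrices n" and n: "0 < n"
    using assms(4) by (auto simp: hadamard_orders_def)
  have "unconditional_bound \<phi> 1"
    using assms(3) by (simp add: is_unconditional_constant_def)
  then have "1 / sqrt 2 * lam \<phi> n * sqrt (real n) \<le> rho \<phi> n"
    using rho_ge_lam_sqrt [OF _ H n, of \<phi>] by (simp add: real_sqrt_divide mult.commute)
  with rho_ge_order [OF assms(2) H n] show ?thesis by simp
qed

end
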